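(* Let $G$ be a group with derived subgroup $G'$ and centre $\mathcal{Z}(G)$. If $G' \leq \mathcal{Z}(G)$ and $|\mathcal{Z}(G)|^3 < |G|$, then the commuting graph $\Gamma(G)$ has diameter $\operatorname{diam}(\Gamma(G)) = 2$.
   Context: The commuting graph $\Gamma(G)$ of a group $G$ is the simple undirected graph whose vertices are the non-central elements of $G$, with two distinct vertices $x,y$ adjacent if and only if $xy=yx$. The distance between two vertices is the length of a shortest path between them ($\infty$ if there is none), and the diameter is the maximum distance between two vertices. The derived subgroup $G'$ is the subgroup generated by all commutators $[g,h]=g^{-1}h^{-1}gh$ with $g,h\in G$. *)

theory Defs
  imports
    "HOL-Algebra.Generated_Groups"
    "HOL-Library.Equipollence"
    "HOL-Library.Extended_Nat"
    "Graph_Theory.Pair_Digraph"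
begin

definition centre :: "('a, 'b) monoid_scheme \<Rightarrow> 'a set" where
  "centre G = {z \<in> carrier G. \<forall>g\<in>carrier G. g \<otimes>\<^bsub>G\<^esub> z = z \<otimes>\<^bsub>G\<^esub> g}"

(* A simple undirected graph is a symmetric, loop-free digraph without parallel arcs. *)
definition commuting_graph :: "('a, 'b) monoid_scheme \<Rightarrow> 'a pair_pre_digraph" where
  "commuting_graph G = \<lparr>
     pverts = carrier G - centre G,
     parcs = {(x, y). x \<in> carrier G - centre G \<and> y \<in> carrier G - centre G \<and>
                      x \<noteq> y \<and> x \<otimes>\<^bsub>G\<^esub> y = y \<otimes>\<^bsub>G\<^esub> x} \<rparr>"

lemma pair_bidirected_digraph_commuting_graph: "pair_bidirected_digraph (commuting_graph G)"
  by unfold_locales (auto simp: commuting_graph_def symmetric_def sym_def)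

(* The infimum is attained when a path exists; otherwise it is Inf {} = \<infinity>. *)
definition graph_dist :: "('a, 'b) pre_digraph \<Rightarrow> 'a \<Rightarrow> 'a \<Rightarrow> enat" where
  "graph_dist \<Gamma> u v = (INF p \<in> {p. pre_digraph.apath \<Gamma> u p v}. enat (length p))"

(* A finite supremum of a non-empty set in enat is a maximum. *)
definition graph_diameter :: "('a, 'b) pre_digraph \<Rightarrow> enat" where
  "graph_diameter \<Gamma> = (SUP (u, v) \<in> verts \<Gamma> \<times> verts \<Gamma>. graph_dist \<Gamma> u v)"

(* derived_set uses g h g^-1 h^-1; as g and h range over G this is the same set of commutators. *)
lemma (in group) derived_carrier_eq:
  "derived G (carrier G) =
     generate G {inv g \<otimes> inv h \<otimes> g \<otimes> h | g h. g \<in> carrier G \<and> h \<in> carrier G}"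
proof -
  have "derived_set G (carrier G) =
      {inv g \<otimes> inv h \<otimes> g \<otimes> h | g h. g \<in> carrier G \<and> h \<in> carrier G}" (is "?L = ?R")
  proof
    show "?L \<subseteq> ?R"
    proof
      fix x assume "x \<in> ?L"
      then obtain g h where gh: "g \<in> carrier G" "h \<in> carrier G"
        "x = inv (inv g) \<otimes> inv (inv h) \<otimes> inv g \<otimes> inv h" by auto
      then show "x \<in> ?R" by blast
    qed
    show "?R \<subseteq> ?L"
    proof
      fix x assume "x \<in> ?R"
      then obtain g h where gh: "g \<in> carrier G" "h \<in> carrier G"
        "x = inv g \<otimes> inv h \<otimes> inv (inv g) \<otimes> inv (inv h)" by auto
      then show "x \<in> ?L" by blast
    qed
  qed
  then show ?thesis by (simp add: derived_def)
qed

(* A \<times> A \<times> A \<prec> B expresses |A|^3 < |B| for arbitrary, possibly infinite, cardinalities. *)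
lemma cube_lesspoll_iff:
  assumes "finite B"
  shows "A \<times> A \<times> A \<prec> B \<longleftrightarrow> finite A \<and> card A ^ 3 < card B"
proof (cases "finite A")
  case True
  have "A \<times> A \<times> A \<prec> B \<longleftrightarrow> card (A \<times> A \<times> A) < card B"
    using True assms
    by (metis finite_cartesian_product lesspoll_def lepoll_iff_card_le
        eqpoll_iff_card le_neq_implies_less less_imp_le nat_neq_iff)
  with True show ?thesis by (simp add: card_cartesian_product power3_eq_cube mult.assoc)
next
  case False
  then have "infinite (A \<times> A \<times> A)" by (auto simp: finite_cartesian_product_iff)
  then show ?thesis
    using False assms lepoll_iff_finite_card lesspoll_imp_lepoll
    by (metis finite_lepoll_infinite lepoll_def inj_on_finite)
qed

end

(* For non-central x and y, the map g |-> ([x,g], [y,g]) into Z(G) x Z(G) has the cosets of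
   C(x) \<inter> C(y) as its fibres, because commutators are central. If C(x) \<inter> C(y) were contained in
   Z(G), recording in addition the quotient of g by a chosen representative of its fibre would
   inject G into Z(G)^3. So any two vertices have a common non-central centralizing element. *)
theory Submission
  imports Defs
begin

context group
begin

lemma commutator_in_derived:
  assumes "x \<in> carrier G" "g \<in> carrier G"
  shows "x \<otimes> g \<otimes> inv x \<otimes> inv g \<in> derived G (carrier G)"
  unfolding derived_def by (rule generate.incl) (use assms in blast)

text \<open>Moving \<open>x\<close> past \<open>g\<close> or past \<open>h\<close> costs the same
  factor, the common commutator \<open>c\<close>. As \<open>c\<close> is central, the two factors
  cancel in \<open>g \<otimes> inv h\<close>.\<close>

lemma commutes_if_commutator_eq:
  assumes "x \<in> carrier G" "g \<in> carrier G" "h \<in> carrier G"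
    and eq: "x \<otimes> g \<otimes> inv x \<otimes> inv g = x \<otimes> h \<otimes> inv x \<otimes> inv h"
    and central: "x \<otimes> h \<otimes> inv x \<otimes> inv h \<in> centre G"
  shows "x \<otimes> (g \<otimes> inv h) = (g \<otimes> inv h) \<otimes> x"
proof -
  define c where "c = x \<otimes> h \<otimes> inv x \<otimes> inv h"
  have c: "c \<in> carrier G" and comm: "\<And>k. k \<in> carrier G \<Longrightarrow> k \<otimes> c = c \<otimes> k"
    using central by (auto simp: c_def centre_def)
  \<comment> \<open>By \<open>eq\<close>, \<open>c\<close> is also the commutator of
    \<open>x\<close> with \<open>g\<close>.\<close>
  have g: "x \<otimes> g = c \<otimes> g \<otimes> x"
    using assms(1-3) eq by (simp add: c_def flip: eq) (simp add: m_assoc)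
  have h: "x \<otimes> h = c \<otimes> h \<otimes> x"
    using assms(1-3) by (simp add: c_def m_assoc)
  have "(x \<otimes> (g \<otimes> inv h)) \<otimes> h = c \<otimes> g \<otimes> x"
    using assms(1-3) g by (simp add: m_assoc)
  also have "\<dots> = g \<otimes> (c \<otimes> x)"
    using assms(1-3) c comm[of g] by (simp flip: m_assoc)
  \<comment> \<open>Inserting \<open>inv h \<otimes> h\<close> makes room to swap \<open>h\<close>
    with the central \<open>c\<close>, so that the factor \<open>c\<close> is absorbed into
    \<open>x \<otimes> h\<close>.\<close>
  also have "c \<otimes> x = inv h \<otimes> (h \<otimes> c \<otimes> x)"
    using assms(1-3) c by (simp add: m_assoc inv_solve_left)
  also have "h \<otimes> c \<otimes> x = x \<otimes> h"
    using assms(1-3) comm[of h] h by simp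
  finally have "(x \<otimes> (g \<otimes> inv h)) \<otimes> h = ((g \<otimes> inv h) \<otimes> x) \<otimes> h"
    using assms(1-3) by (simp add: m_assoc)
  then show ?thesis
    using assms(1-3) by (metis inv_closed m_closed right_cancel)
qed

lemma exists_noncentral_commuting_with_both:
  assumes derived: "derived G (carrier G) \<subseteq> centre G"
    and card: "centre G \<times> centre G \<times> centre G \<prec> carrier G"
    and x: "x \<in> carrier G" and y: "y \<in> carrier G"
  shows "\<exists>z \<in> carrier G - centre G. x \<otimes> z = z \<otimes> x \<and> y \<otimes> z = z \<otimes> y"
proof (rule ccontr)
  assume "\<not> ?thesis"
  then have K: "z \<in> centre G"
    if "z \<in> carrier G" "x \<otimes> z = z \<otimes> x" "y \<otimes> z = z \<otimes> y" for z
    using that by blast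
  define \<phi> where "\<phi> g = (x \<otimes> g \<otimes> inv x \<otimes> inv g, y \<otimes> g \<otimes> inv y \<otimes> inv g)" for g
  \<comment> \<open>The representative is a function of the value of \<open>\<phi>\<close> alone, so
    all elements of a fibre share it; the injectivity of \<open>\<psi>\<close> rests on
    this.\<close>
  define r where "r p = (SOME h. h \<in> carrier G \<and> \<phi> h = p)" for p
  have r: "r (\<phi> g) \<in> carrier G" "\<phi> (r (\<phi> g)) = \<phi> g" if "g \<in> carrier G" for g
    using someI[of "\<lambda>h. h \<in> carrier G \<and> \<phi> h = \<phi> g" g] that by (auto simp: r_def)
  have \<phi>: "\<phi> g \<in> centre G \<times> centre G" if "g \<in> carrier G" for g
    using that x y derived commutator_in_derived by (auto simp: \<phi>_def)
  \<comment> \<open>An element and its representative have equal commutators with \<open>x\<close>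
    and with \<open>y\<close>, so their quotient commutes with both and \<open>K\<close>
    applies.\<close>
  have quot: "g \<otimes> inv r (\<phi> g) \<in> centre G" if g: "g \<in> carrier G" for g
  proof (rule K)
    note h = r[OF g]
    show "g \<otimes> inv r (\<phi> g) \<in> carrier G"
      using g h by simp
    show "x \<otimes> (g \<otimes> inv r (\<phi> g)) = g \<otimes> inv r (\<phi> g) \<otimes> x"
      using commutes_if_commutator_eq[OF x g h(1)] \<phi>[OF h(1)] h(2) unfolding \<phi>_def by auto
    show "y \<otimes> (g \<otimes> inv r (\<phi> g)) = g \<otimes> inv r (\<phi> g) \<otimes> y"
      using commutes_if_commutator_eq[OF y g h(1)] \<phi>[OF h(1)] h(2) unfolding \<phi>_def by auto
  qed
  define \<psi> where "\<psi> g = (g \<otimes> inv r (\<phi> g), \<phi> g)" for g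
  \<comment> \<open>The second component determines \<open>r (\<phi> g)\<close>, and cancelling its
    inverse in the first recovers \<open>g\<close>.\<close>
  have "inj_on \<psi> (carrier G)"
    by (rule inj_onI) (auto simp: \<psi>_def r)
  moreover have "\<psi> ` carrier G \<subseteq> centre G \<times> centre G \<times> centre G"
    using quot \<phi> unfolding \<psi>_def by blast
  ultimately have "carrier G \<lesssim> centre G \<times> centre G \<times> centre G"
    by (auto simp: lepoll_def)
  with card show False
    by (meson lepoll_antisym lesspoll_def)
qed

text \<open>This supplies the two vertices at distance at least 2. An abelian group would equal its
  centre, which embeds into its own cube, against strictness.\<close>

lemma noncommuting_pair_if_cube_centre_lesspoll:
  assumes "centre G \<times> centre G \<times> centre G \<prec> carrier G"
  obtains x y where "x \<in> carrier G - centre G" "y \<in> carrier G - centre G"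
    "x \<otimes> y \<noteq> y \<otimes> x"
proof -
  have "\<one> \<in> centre G"
    by (simp add: centre_def)
  then have "centre G \<lesssim> centre G \<times> centre G \<times> centre G"
    unfolding lepoll_def by (intro exI[of _ "\<lambda>z. (z, \<one>, \<one>)"]) (auto simp: inj_on_def)
  with assms have "carrier G \<noteq> centre G"
    by (metis lepoll_antisym lesspoll_def)
  then obtain x where x: "x \<in> carrier G - centre G"
    by (auto simp: centre_def)
  then obtain y where "y \<in> carrier G" "x \<otimes> y \<noteq> y \<otimes> x"
    by (auto simp: centre_def)
  then show thesis
    using x by (intro that[of x y]) (auto simp: centre_def)
qed

end

text \<open>A walk of length 0 forces \<open>u = v\<close>, and a walk of length 1 is the arc
  \<open>(u, v)\<close> itself.\<close>

lemma two_le_graph_dist: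
  assumes "u \<noteq> v" and "(u, v) \<notin> parcs \<Gamma>"
  shows "2 \<le> graph_dist (with_proj \<Gamma>) u v"
  unfolding graph_dist_def
proof (rule INF_greatest)
  fix p assume "p \<in> {p. pre_digraph.apath (with_proj \<Gamma>) u p v}"
  then have "pre_digraph.awalk (with_proj \<Gamma>) u p v"
    by (simp add: pre_digraph.apath_def)
  then have "length p \<ge> 2"
    using assms
    by (cases p; cases "tl p")
      (auto simp: pre_digraph.awalk_def pre_digraph.cas.simps)
  then show "2 \<le> enat (length p)"
    by (simp add: numeral_eq_enat)
qed

lemma graph_dist_le_length:
  "pre_digraph.apath \<Gamma> u p v \<Longrightarrow> graph_dist \<Gamma> u v \<le> enat (length p)"
  unfolding graph_dist_def by (rule INF_lower) simp

theorem theorem1p4: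
  fixes G :: "('a, 'b) monoid_scheme"
  assumes "group G"
    and "derived G (carrier G) \<subseteq> centre G"
    and "centre G \<times> centre G \<times> centre G \<prec> carrier G"
  shows "graph_diameter (with_proj (commuting_graph G)) = 2"
proof -
  interpret group G by fact
  let ?\<Gamma> = "with_proj (commuting_graph G)"
  note path_simps = pre_digraph.apath_def pre_digraph.awalk_def pre_digraph.cas.simps
    pre_digraph.awalk_verts.simps commuting_graph_def
  have upper: "graph_dist ?\<Gamma> u v \<le> 2"
    if u: "u \<in> carrier G - centre G" and v: "v \<in> carrier G - centre G" for u v
  proof -
    obtain z where z: "z \<in> carrier G - centre G"
        "u \<otimes>\<^bsub>G\<^esub> z = z \<otimes>\<^bsub>G\<^esub> u" "v \<otimes>\<^bsub>G\<^esub> z = z \<otimes>\<^bsub>G\<^esub> v"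
      using exists_noncentral_commuting_with_both[OF assms(2,3), of u v] u v by auto
    \<comment> \<open>An \<open>apath\<close> repeats no vertex, and \<open>z\<close> may coincide
      with \<open>u\<close> or \<open>v\<close> when these commute. In the last case it cannot,
      since \<open>z\<close> commutes with both, so the path through \<open>z\<close> is
      legitimate.\<close>
    consider "u = v" | "u \<noteq> v" "u \<otimes>\<^bsub>G\<^esub> v = v \<otimes>\<^bsub>G\<^esub> u" | "u \<otimes>\<^bsub>G\<^esub> v \<noteq> v \<otimes>\<^bsub>G\<^esub> u"
      by blast
    then obtain p where p: "pre_digraph.apath ?\<Gamma> u p v" "length p \<le> 2"
    proof cases
      case 1
      then show thesis
        using u by (intro that[of "[]"]) (auto simp: path_simps)
    next
      case 2
      then show thesis
        using u v by (intro that[of "[(u, v)]"]) (auto simp: path_simps)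
    next
      case 3
      then show thesis
        using u v z by (intro that[of "[(u, z), (z, v)]"]) (auto simp: path_simps)
    qed
    have "graph_dist ?\<Gamma> u v \<le> enat (length p)"
      using p(1) by (rule graph_dist_le_length)
    also have "\<dots> \<le> 2"
      using p(2) by (simp add: numeral_eq_enat)
    finally show ?thesis .
  qed
  obtain x y where x: "x \<in> carrier G - centre G" and y: "y \<in> carrier G - centre G"
    and xy: "x \<otimes>\<^bsub>G\<^esub> y \<noteq> y \<otimes>\<^bsub>G\<^esub> x"
    using noncommuting_pair_if_cube_centre_lesspoll[OF assms(3)] .
  show ?thesis
  proof (rule antisym)
    show "graph_diameter ?\<Gamma> \<le> 2"
      unfolding graph_diameter_def using upper
      by (intro SUP_least) (auto simp: commuting_graph_def)
    have "2 \<le> graph_dist ?\<Gamma> x y"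
      using xy by (intro two_le_graph_dist) (auto simp: commuting_graph_def)
    also have "\<dots> \<le> graph_diameter ?\<Gamma>"
      unfolding graph_diameter_def
      using x y by (intro SUP_upper2[of "(x, y)"]) (auto simp: commuting_graph_def)
    finally show "2 \<le> graph_diameter ?\<Gamma>" .
  qed
qed

end
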